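(* Let $X$ be a separable Hilbert space, $m\ge1$, and $f(z)=\sum_{k\ge0}\hat f(\alpha_k)z^{\alpha_k}\in H^2(\mathbb{D}^m,X)$, where $\sigma(f)=\{\alpha_k:k\ge0\}\subset\mathbb{Z}_+^m$ (distinct multi-indices $\alpha_k=(\alpha_{k,1},\dots,\alpha_{k,m})$) satisfies: (C1) there is a constant $C$ such that for every $\beta\in\mathbb{Z}^m$, $\#\{(\alpha,\alpha')\in\sigma(f)^2:\alpha\neq\alpha',\ \alpha-\alpha'=\beta\}\le C$; (C2) $\lim_{k\to\infty}(\alpha_{k+1,j}-\alpha_{k,j})=\infty$ for every $j=1,\dots,m$; and suppose $(\hat f(\alpha_k))_{k\ge0}$ is completely relatively compact in $X$. Then $f$ is cyclic for the backward shift semigroup in $H^2(\mathbb{D}^m,X)$ if and only if $\operatorname{span}\{\hat f(\alpha_j):j\ge k\}=X$ for every $k\ge0$.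
   Context: $H^2(\mathbb{D}^m,X)=\{f(z)=\sum_{\alpha\in\mathbb{Z}_+^m}\hat f(\alpha)z^\alpha:\hat f(\alpha)\in X,\ \sum\|\hat f(\alpha)\|^2<\infty\}$, $z^\alpha=z_1^{\alpha_1}\cdots z_m^{\alpha_m}$. For $\alpha\in\mathbb{Z}_+^m$, $S^{*\alpha}f(z)=\sum_{\beta\ge0}\hat f(\alpha+\beta)z^\beta$. $E_f$ is the closed span of $\{S^{*\alpha}f:\alpha\in\mathbb{Z}_+^m\}$ and $f$ is cyclic if $E_f=H^2(\mathbb{D}^m,X)$. $\sigma(f)=\{\alpha:\hat f(\alpha)\ne0\}$. Completely relatively compact: for every orthogonal projection $P$ on $X$, $(Pa_k/\|Pa_k\|)_{Pa_k\ne0}$ is relatively compact. span = closed linear span. *)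

theory Defs
  imports "HOL-Analysis.Analysis"
begin

text \<open>A complex Hilbert space, presented as a real Hilbert space together with
  an orthogonal complex structure imul (multiplication by the imaginary unit).
  Complex scalar multiplication is then (a + b i) x = a x + b (imul x).\<close>
class complex_hilbert = real_inner + complete_space +
  fixes imul :: "'a \<Rightarrow> 'a"
  assumes imul_add: "imul (x + y) = imul x + imul y"
    and imul_scaleR: "imul (scaleR r x) = scaleR r (imul x)"
    and imul_imul: "imul (imul x) = - x"
    and inner_imul: "inner (imul x) (imul y) = inner x y"

definition cscale :: "complex \<Rightarrow> 'a::complex_hilbert \<Rightarrow> 'a" where
  "cscale c x = scaleR (Re c) x + scaleR (Im c) (imul x)"

definition cspan :: "'a::complex_hilbert set \<Rightarrow> 'a set" where
  "cspan S = {x. \<exists>F c. finite F \<and> F \<subseteq> S \<and> x = (\<Sum>s\<in>F. cscale (c s) s)}"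

definition separable_space :: "'a::metric_space itself \<Rightarrow> bool" where
  "separable_space _ \<longleftrightarrow> (\<exists>D::'a set. countable D \<and> closure D = UNIV)"

definition orth_proj :: "('a::complex_hilbert \<Rightarrow> 'a) \<Rightarrow> bool" where
  "orth_proj P \<longleftrightarrow> bounded_linear P \<and> (\<forall>x. P (imul x) = imul (P x))
     \<and> (\<forall>x. P (P x) = P x) \<and> (\<forall>x y. inner (P x) y = inner x (P y))"

definition completely_rel_compact :: "(nat \<Rightarrow> 'a::complex_hilbert) \<Rightarrow> bool" where
  "completely_rel_compact a \<longleftrightarrow> (\<forall>P. orth_proj P \<longrightarrow>
     compact (closure {scaleR (1 / norm (P (a k))) (P (a k)) | k. P (a k) \<noteq> 0}))"

text \<open>Multi-indices in Z_+^m are functions 'm \<Rightarrow> nat, with 'm a finite (nonempty) index type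
  of cardinality m. An element of H^2(D^m, X) is identified with its coefficient
  function alpha \<mapsto> hat f(alpha).\<close>
definition H2 :: "(('m::finite \<Rightarrow> nat) \<Rightarrow> 'a::complex_hilbert) set" where
  "H2 = {f. (\<lambda>\<alpha>. (norm (f \<alpha>))\<^sup>2) summable_on UNIV}"

definition h2norm :: "(('m::finite \<Rightarrow> nat) \<Rightarrow> 'a::complex_hilbert) \<Rightarrow> real" where
  "h2norm f = sqrt (infsum (\<lambda>\<alpha>. (norm (f \<alpha>))\<^sup>2) UNIV)"

definition bshift :: "('m::finite \<Rightarrow> nat) \<Rightarrow> (('m \<Rightarrow> nat) \<Rightarrow> 'a) \<Rightarrow> (('m \<Rightarrow> nat) \<Rightarrow> 'a)" where
  "bshift \<alpha> f = (\<lambda>\<beta>. f (\<lambda>j. \<alpha> j + \<beta> j))"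

definition h2cspan :: "(('m::finite \<Rightarrow> nat) \<Rightarrow> 'a::complex_hilbert) set \<Rightarrow> (('m \<Rightarrow> nat) \<Rightarrow> 'a) set" where
  "h2cspan S = {g. \<exists>F c. finite F \<and> F \<subseteq> S \<and> g = (\<lambda>\<beta>. \<Sum>h\<in>F. cscale (c h) (h \<beta>))}"

definition Ef :: "(('m::finite \<Rightarrow> nat) \<Rightarrow> 'a::complex_hilbert) \<Rightarrow> (('m \<Rightarrow> nat) \<Rightarrow> 'a) set" where
  "Ef f = {g \<in> H2. \<forall>e>0. \<exists>h\<in>h2cspan (range (\<lambda>\<alpha>. bshift \<alpha> f)).
             h2norm (\<lambda>\<beta>. g \<beta> - h \<beta>) < e}"

definition cyclic :: "(('m::finite \<Rightarrow> nat) \<Rightarrow> 'a::complex_hilbert) \<Rightarrow> bool" where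
  "cyclic f \<longleftrightarrow> Ef f = H2"

definition spec :: "(('m::finite \<Rightarrow> nat) \<Rightarrow> 'a::complex_hilbert) \<Rightarrow> ('m \<Rightarrow> nat) set" where
  "spec f = {\<alpha>. f \<alpha> \<noteq> 0}"

end

theory Submission
  imports Defs
begin

text \<open>
  If \<open>f\<close> is cyclic, approximating \<open>x z\<^sup>\<beta>\<close> by combinations of shifts and comparing the coefficients at
  a multi-index \<open>\<beta>\<close> beyond \<open>\<alpha>\<^sub>0, \<dots>, \<alpha>\<^sub>k\<close> approximates \<open>x\<close> by combinations of later coefficients.

  Conversely, let \<open>Y\<close> be the closed subspace of all \<open>x\<close> such that every \<open>x z\<^sup>\<beta>\<close> lies in \<open>E\<^sub>f\<close>, let \<open>P\<close>
  be the projection onto its orthogonal complement, and put \<open>b\<^sub>k = P f(\<alpha>\<^sub>k)\<close>. Shifts of \<open>P f\<close> stay in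
  \<open>E\<^sub>f\<close>. If \<open>b\<^sub>k = 0\<close> for all large \<open>k\<close>, density of the tail spans gives \<open>Y = X\<close>. Otherwise let \<open>R\<^sub>k\<close> be
  the sum of \<open>|b\<^sub>j|\<^sup>2\<close> over \<open>j > k\<close>; by Abel and Dini the series of \<open>w\<^sub>k = |b\<^sub>k|\<^sup>2 / R\<^sub>k\<close> diverges, and by
  compactness it already diverges over those \<open>k\<close> for which \<open>b\<^sub>k / |b\<^sub>k|\<close> is close to some unit vector
  \<open>u\<close>. Average the shifts of \<open>P f\<close> by \<open>\<alpha>\<^sub>k - \<beta>\<close>, divided by \<open>|b\<^sub>k|\<close>, with weights proportional to \<open>w\<^sub>k\<close>
  over a finite set of such \<open>k\<close> of total weight \<open>W\<close>. The coefficient at \<open>\<beta>\<close> is close to \<open>u\<close>; since each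
  difference occurs at most \<open>C\<close> times, the rest has squared norm at most \<open>C / W\<close>. Hence \<open>u \<in> Y\<close>,
  although \<open>P u = u \<noteq> 0\<close>.
\<close>

section \<open>Complex scalars and orthogonal projections\<close>

text \<open>An isometry with square -1 is skew, so the value equals its own negative.\<close>

lemma inner_imul_self: "inner x (imul x) = 0"
  using inner_imul[of x "imul x"] by (simp add: imul_imul inner_commute)

lemma imul_minus: "imul (- x) = - imul x"
  using imul_scaleR[of "-1" x] by simp

lemma imul_diff: "imul (x - y) = imul x - imul y"
  using imul_add[of x "- y"] by (simp add: imul_minus)

lemma inner_imul_left: "inner (imul x) y = - inner x (imul y)"
  using inner_imul[of x "imul y"] by (simp add: imul_imul)

text \<open>Pythagoras: \<open>x\<close> and \<open>imul x\<close> are orthogonal and have equal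
  norms.\<close>

lemma norm_cscale: "norm (cscale c x) = cmod c * norm x"
proof -
  have "(norm (cscale c x))\<^sup>2 = ((Re c)\<^sup>2 + (Im c)\<^sup>2) * (norm x)\<^sup>2"
    unfolding cscale_def power2_norm_eq_inner
    by (simp add: inner_add_left inner_add_right inner_imul inner_imul_self inner_commute[of "imul x"] power2_eq_square algebra_simps)
  also have "\<dots> = (cmod c * norm x)\<^sup>2"
    by (simp add: cmod_power2 power_mult_distrib)
  finally show ?thesis by simp
qed

lemma cscale_zero_left [simp]: "cscale 0 x = 0"
  by (simp add: cscale_def)

lemma cscale_one [simp]: "cscale 1 x = x"
  by (simp add: cscale_def)

lemma cscale_of_real: "cscale (of_real r) x = r *\<^sub>R x"
  by (simp add: cscale_def)

lemma cscale_ii: "cscale \<i> x = imul x"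
  by (simp add: cscale_def)

lemma cscale_add_right: "cscale c (x + y) = cscale c x + cscale c y"
  by (simp add: cscale_def imul_add algebra_simps)

lemma cscale_add_left: "cscale (c + d) x = cscale c x + cscale d x"
  by (simp add: cscale_def algebra_simps)

lemma cscale_diff_right: "cscale c (x - y) = cscale c x - cscale c y"
  by (simp add: cscale_def imul_diff algebra_simps)

lemma cscale_cscale: "cscale c (cscale d x) = cscale (c * d) x"
  by (simp add: cscale_def imul_add imul_scaleR imul_imul algebra_simps)

lemma cscale_zero_right [simp]: "cscale c 0 = 0"
  using norm_cscale[of c 0] by simp

lemma cscale_sum_right: "cscale c (\<Sum>i\<in>I. g i) = (\<Sum>i\<in>I. cscale c (g i))"
  by (induction I rule: infinite_finite_induct) (simp_all add: cscale_add_right)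

section \<open>Projections onto closed subspaces\<close>

text \<open>A sequence minimising the distance from \<open>x\<close> to \<open>Y\<close> is Cauchy
  by the parallelogram law; minimality of its limit \<open>l\<close> along the lines
  \<open>l + t *\<^sub>R z\<close> forces orthogonality.\<close>

lemma closed_subspace_orthogonal_decomposition:
  fixes Y :: "'a::{real_inner,complete_space} set"
  assumes sub: "subspace Y" and cl: "closed Y"
  shows "\<exists>y\<in>Y. \<forall>z\<in>Y. inner (x - y) z = 0"
proof -
  define d where "d = (INF y\<in>Y. (norm (x - y))\<^sup>2)"
  have bdd: "bdd_below ((\<lambda>y. (norm (x - y))\<^sup>2) ` Y)"
    by (rule bdd_belowI[of _ 0]) auto
  have ne: "Y \<noteq> {}" using subspace_0[OF sub] by auto
  have d_le: "d \<le> (norm (x - y))\<^sup>2" if "y \<in> Y" for y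
    unfolding d_def by (rule cINF_lower[OF bdd that])
  have "\<exists>y\<in>Y. (norm (x - y))\<^sup>2 < d + 1 / real (Suc n)" for n
    unfolding d_def using cINF_less_iff[OF ne bdd, of "d + 1 / real (Suc n)"]
    by (simp add: d_def)
  then obtain y where yY: "\<And>n. y n \<in> Y"
    and y: "\<And>n. (norm (x - y n))\<^sup>2 < d + 1 / real (Suc n)" by metis
  have par: "(norm (y n - y m))\<^sup>2 \<le> 2 / real (Suc n) + 2 / real (Suc m)" for n m
  proof -
    \<comment> \<open>The midpoint stays in \<open>Y\<close>, so its squared distance from
      \<open>x\<close> is at least \<open>d\<close>; this turns the parallelogram law into a bound
      on the gap.\<close>
    define w where "w = (1/2) *\<^sub>R (y n + y m)"
    have "w \<in> Y" unfolding w_def using sub yY by (simp add: subspace_add subspace_scale)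
    have "(norm (y n - y m))\<^sup>2 + 4 * (norm (x - w))\<^sup>2
        = 2 * (norm (x - y n))\<^sup>2 + 2 * (norm (x - y m))\<^sup>2"
      unfolding w_def power2_norm_eq_inner
      by (simp add: inner_diff_left inner_diff_right inner_add_left inner_add_right
          inner_commute algebra_simps)
    then show ?thesis using d_le[OF \<open>w \<in> Y\<close>] y[of n] y[of m] by simp
  qed
  have "Cauchy y"
  proof (rule metric_CauchyI)
    fix e :: real assume "e > 0"
    obtain N where N: "4 / e\<^sup>2 < real (Suc N)"
      using reals_Archimedean2[of "4 / e\<^sup>2"] by (metis less_Suc_eq of_nat_less_iff order_less_trans)
    have "dist (y m) (y n) < e" if "m \<ge> N" "n \<ge> N" for m n
    proof -
      have "2 / real (Suc m) \<le> 2 / real (Suc N)" "2 / real (Suc n) \<le> 2 / real (Suc N)"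
        using that by (auto intro!: divide_left_mono)
      then have "(norm (y m - y n))\<^sup>2 \<le> 4 / real (Suc N)"
        using par[of m n] by simp
      also have "\<dots> < e\<^sup>2"
        using N \<open>e > 0\<close> by (simp add: field_simps)
      finally show ?thesis
        using \<open>e > 0\<close> by (simp add: dist_norm power2_less_imp_less)
    qed
    then show "\<exists>M. \<forall>m\<ge>M. \<forall>n\<ge>M. dist (y m) (y n) < e" by blast
  qed
  then obtain l where l: "y \<longlonglongrightarrow> l"
    using Cauchy_convergent convergent_def by blast
  have lY: "l \<in> Y" using closed_sequentially[OF cl] yY l by blast
  have "(\<lambda>n. (norm (x - y n))\<^sup>2) \<longlonglongrightarrow> (norm (x - l))\<^sup>2"
    by (intro tendsto_intros l)
  moreover have "(\<lambda>n. d + 1 / real (Suc n)) \<longlonglongrightarrow> d + 0"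
    by (intro tendsto_intros LIMSEQ_Suc[OF lim_1_over_n])
  ultimately have ld: "(norm (x - l))\<^sup>2 \<le> d"
    using y by (intro LIMSEQ_le[of "\<lambda>n. (norm (x - y n))\<^sup>2" _ "\<lambda>n. d + 1 / real (Suc n)"])
      (auto intro: less_imp_le)
  have "inner (x - l) z = 0" if zY: "z \<in> Y" for z
  proof (cases "z = 0")
    case False
    \<comment> \<open>This \<open>t\<close> minimises the squared distance from \<open>x\<close> to
      \<open>l + t *\<^sub>R z\<close>; the decrease it would bring must vanish.\<close>
    define t where "t = inner (x - l) z / (norm z)\<^sup>2"
    have "l + t *\<^sub>R z \<in> Y" using sub lY zY by (simp add: subspace_add subspace_scale)
    from d_le[OF this] ld have "(norm (x - l))\<^sup>2 \<le> (norm ((x - l) - t *\<^sub>R z))\<^sup>2"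
      unfolding diff_diff_add by linarith
    also have "\<dots> = (norm (x - l))\<^sup>2 - 2 * t * inner (x - l) z + t\<^sup>2 * (norm z)\<^sup>2"
      unfolding power2_norm_eq_inner
      by (simp add: inner_diff_left inner_diff_right inner_commute power2_eq_square algebra_simps)
    also have "\<dots> = (norm (x - l))\<^sup>2 - (inner (x - l) z)\<^sup>2 / (norm z)\<^sup>2"
      using False by (simp add: t_def field_simps power2_eq_square)
    finally have "(inner (x - l) z)\<^sup>2 / (norm z)\<^sup>2 \<le> 0" by simp
    then show ?thesis using False by (simp add: divide_le_0_iff)
  qed simp
  then show ?thesis using lY by blast
qed

text \<open>Uniqueness of the orthogonal foot \<open>Q x\<close> gives linearity, and invariance of
  \<open>Y\<close> under \<open>imul\<close> makes \<open>Q\<close> commute with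
  \<open>imul\<close>. Subtracting \<open>Q\<close> from the identity projects onto the
  complement.\<close>

lemma orth_proj_complement_exists:
  fixes Y :: "'a::complex_hilbert set"
  assumes sub: "subspace Y" and cl: "closed Y" and im: "\<And>x. x \<in> Y \<Longrightarrow> imul x \<in> Y"
  obtains P where "orth_proj P" "\<And>x. x - P x \<in> Y" "\<And>x. x \<in> Y \<Longrightarrow> P x = 0"
proof -
  obtain Q where QY: "\<And>x. Q x \<in> Y" and Qo: "\<And>x z. z \<in> Y \<Longrightarrow> inner (x - Q x) z = 0"
    using closed_subspace_orthogonal_decomposition[OF sub cl] by metis
  have uniq: "Q x = y" if "y \<in> Y" "\<And>z. z \<in> Y \<Longrightarrow> inner (x - y) z = 0" for x y
  proof -
    have d: "Q x - y \<in> Y" using sub QY that by (simp add: subspace_diff)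
    have "inner (Q x - y) (Q x - y) = inner (x - y) (Q x - y) - inner (x - Q x) (Q x - y)"
      by (simp add: inner_diff_left)
    then have "inner (Q x - y) (Q x - y) = 0" using Qo[OF d] that(2)[OF d] by simp
    then show ?thesis by simp
  qed
  have Qadd: "Q (x + y) = Q x + Q y" for x y
    using Qo[of _ x] Qo[of _ y] sub QY
    by (intro uniq) (auto simp: subspace_add inner_diff_left inner_add_left)
  have Qscale: "Q (r *\<^sub>R x) = r *\<^sub>R Q x" for r x
    using Qo[of _ x] sub QY
    by (intro uniq) (auto simp: subspace_scale inner_diff_left)
  have Qimul: "Q (imul x) = imul (Q x)" for x
    using Qo[of _ x] im QY
    by (intro uniq) (auto simp: inner_diff_left inner_imul_left)
  have QQ: "Q x = x" if "x \<in> Y" for x using that by (intro uniq) auto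
  have Qsym: "inner (Q x) y = inner x (Q y)" for x y
    using Qo[OF QY[of x], of y] Qo[OF QY[of y], of x]
    by (simp add: inner_diff_left inner_diff_right inner_commute)
  define P where "P x = x - Q x" for x
  have "norm (P x) \<le> norm x * 1" for x
  proof -
    have "(norm (P x))\<^sup>2 = inner x (P x)"
      using Qo[OF QY[of x], of x]
      by (simp add: P_def power2_norm_eq_inner inner_diff_right inner_diff_left inner_commute)
    also have "\<dots> \<le> norm x * norm (P x)" by (rule norm_cauchy_schwarz)
    finally show ?thesis by (cases "P x = 0") (auto simp: power2_eq_square)
  qed
  then have "bounded_linear P"
    by (intro bounded_linear_intro[of P 1]) (simp_all add: P_def Qadd Qscale algebra_simps)
  moreover have "P (P x) = P x" for x
  proof -
    have "Q (x - Q x) = 0" using Qo[of _ x] sub by (intro uniq) (auto simp: subspace_0)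
    then show ?thesis by (simp add: P_def)
  qed
  ultimately have "orth_proj P"
    unfolding orth_proj_def
    by (auto simp: P_def Qimul imul_diff inner_diff_left inner_diff_right Qsym)
  with that[of P] QY QQ show thesis by (simp add: P_def)
qed

section \<open>Hardy space over the polydisc\<close>

text \<open>The square of \<open>h2norm\<close>. Working with it replaces the triangle inequality by
  \<open>norm_add_sq_le\<close>, at the price of factors 2.\<close>

definition h2sq :: "(('m::finite \<Rightarrow> nat) \<Rightarrow> 'a::complex_hilbert) \<Rightarrow> real" where
  "h2sq g = (\<Sum>\<^sub>\<infinity>\<gamma>. (norm (g \<gamma>))\<^sup>2)"

lemma norm_add_sq_le:
  fixes x y :: "'a::real_normed_vector"
  shows "(norm (x + y))\<^sup>2 \<le> 2 * (norm x)\<^sup>2 + 2 * (norm y)\<^sup>2"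
proof -
  have "(norm (x + y))\<^sup>2 \<le> (norm x + norm y)\<^sup>2"
    by (simp add: norm_triangle_ineq power_mono)
  also have "\<dots> \<le> 2 * (norm x)\<^sup>2 + 2 * (norm y)\<^sup>2"
    using sum_squares_bound[of "norm x" "norm y"] by (simp add: power2_sum)
  finally show ?thesis .
qed

lemma H2_dominated:
  assumes "F summable_on UNIV" "\<And>\<gamma>. (norm (g \<gamma>))\<^sup>2 \<le> F \<gamma>"
  shows "g \<in> H2" and "h2sq g \<le> infsum F UNIV"
proof -
  have "(\<lambda>\<gamma>. (norm (g \<gamma>))\<^sup>2) summable_on UNIV"
    by (rule summable_on_comparison_test[OF assms(1)]) (use assms(2) in auto)
  then show "g \<in> H2" and "h2sq g \<le> infsum F UNIV"
    unfolding H2_def h2sq_def using assms by (auto intro!: infsum_mono)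
qed

lemma H2_add:
  assumes "g \<in> H2" "h \<in> H2"
  shows "(\<lambda>\<gamma>. g \<gamma> + h \<gamma>) \<in> H2"
    and "h2sq (\<lambda>\<gamma>. g \<gamma> + h \<gamma>) \<le> 2 * h2sq g + 2 * h2sq h"
proof -
  have g: "(\<lambda>\<gamma>. 2 * (norm (g \<gamma>))\<^sup>2) summable_on UNIV"
    and h: "(\<lambda>\<gamma>. 2 * (norm (h \<gamma>))\<^sup>2) summable_on UNIV"
    using assms by (auto simp: H2_def intro!: summable_on_cmult_right)
  note D = H2_dominated[OF summable_on_add[OF g h], of "\<lambda>\<gamma>. g \<gamma> + h \<gamma>"]
  show "(\<lambda>\<gamma>. g \<gamma> + h \<gamma>) \<in> H2" by (rule D(1)) (rule norm_add_sq_le)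
  have "h2sq (\<lambda>\<gamma>. g \<gamma> + h \<gamma>) \<le> (\<Sum>\<^sub>\<infinity>\<gamma>. 2 * (norm (g \<gamma>))\<^sup>2 + 2 * (norm (h \<gamma>))\<^sup>2)"
    by (rule D(2)) (rule norm_add_sq_le)
  also have "\<dots> = 2 * h2sq g + 2 * h2sq h"
    unfolding h2sq_def using assms
    by (subst infsum_add[OF g h]) (auto simp: H2_def infsum_cmult_right)
  finally show "h2sq (\<lambda>\<gamma>. g \<gamma> + h \<gamma>) \<le> 2 * h2sq g + 2 * h2sq h" .
qed

lemma H2_cscale:
  assumes "g \<in> H2"
  shows "(\<lambda>\<gamma>. cscale c (g \<gamma>)) \<in> H2"
    and "h2sq (\<lambda>\<gamma>. cscale c (g \<gamma>)) = (cmod c)\<^sup>2 * h2sq g"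
  using assms unfolding H2_def h2sq_def
  by (auto simp: norm_cscale power_mult_distrib infsum_cmult_right intro!: summable_on_cmult_right)

lemma H2_diff:
  assumes "g \<in> H2" "h \<in> H2"
  shows "(\<lambda>\<gamma>. g \<gamma> - h \<gamma>) \<in> H2"
  using H2_add(1)[OF assms(1) H2_cscale(1)[OF assms(2), of "-1"]] by (simp add: cscale_def)

lemma H2_zero: "(\<lambda>\<gamma>. 0) \<in> H2"
  by (simp add: H2_def)

lemma H2_sum:
  assumes "\<And>i. i \<in> I \<Longrightarrow> g i \<in> H2"
  shows "(\<lambda>\<gamma>. \<Sum>i\<in>I. g i \<gamma>) \<in> H2"
  using assms by (induction I rule: infinite_finite_induct) (auto simp: H2_zero intro: H2_add)

lemma inj_add_multiindex: "inj (\<lambda>\<beta>::'m \<Rightarrow> nat. \<lambda>j. a j + \<beta> j)"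
  by (auto simp: inj_def fun_eq_iff)

lemma H2_bshift:
  assumes "g \<in> H2"
  shows "bshift a g \<in> H2"
proof -
  have "(\<lambda>\<alpha>. (norm (g \<alpha>))\<^sup>2) summable_on range (\<lambda>\<beta> j. a j + \<beta> j)"
    using assms unfolding H2_def by (auto intro: summable_on_subset_banach)
  then show ?thesis
    using summable_on_reindex[OF inj_add_multiindex[of a], of "\<lambda>\<alpha>. (norm (g \<alpha>))\<^sup>2"]
    by (simp add: H2_def bshift_def o_def)
qed

text \<open>The coefficient function of \<open>x\<close> times the power of \<open>z\<close> with
  exponent \<beta>.\<close>

definition monomial :: "('m::finite \<Rightarrow> nat) \<Rightarrow> 'a::complex_hilbert \<Rightarrow> ('m \<Rightarrow> nat) \<Rightarrow> 'a" where
  "monomial \<beta> x = (\<lambda>\<gamma>. if \<gamma> = \<beta> then x else 0)"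

lemma monomial_add: "monomial \<beta> (x + y) = (\<lambda>\<gamma>. monomial \<beta> x \<gamma> + monomial \<beta> y \<gamma>)"
  by (auto simp: monomial_def)

lemma monomial_cscale: "monomial \<beta> (cscale c x) = (\<lambda>\<gamma>. cscale c (monomial \<beta> x \<gamma>))"
  by (auto simp: monomial_def)

lemma has_sum_norm_sq_monomial: "((\<lambda>\<gamma>. (norm (monomial \<beta> x \<gamma>))\<^sup>2) has_sum (norm x)\<^sup>2) UNIV"
proof -
  have "((\<lambda>\<gamma>. (norm (monomial \<beta> x \<gamma>))\<^sup>2) has_sum (\<Sum>\<gamma>\<in>{\<beta>}. (norm (monomial \<beta> x \<gamma>))\<^sup>2)) UNIV"
    by (rule has_sum_finite_neutralI[of "{\<beta>}"]) (auto simp: monomial_def)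
  then show ?thesis by (simp add: monomial_def)
qed

lemma H2_monomial: "monomial \<beta> x \<in> H2" and h2sq_monomial: "h2sq (monomial \<beta> x) = (norm x)\<^sup>2"
  using has_sum_norm_sq_monomial[of \<beta> x]
  by (auto simp: H2_def h2sq_def infsumI intro: has_sum_imp_summable)

lemma norm_le_h2sq:
  assumes "g \<in> H2"
  shows "(norm (g \<beta>))\<^sup>2 \<le> h2sq g"
proof -
  have "(\<Sum>\<gamma>\<in>{\<beta>}. (norm (g \<gamma>))\<^sup>2) \<le> h2sq g"
    unfolding h2sq_def using assms by (intro finite_sum_le_infsum) (auto simp: H2_def)
  then show ?thesis by simp
qed

section \<open>The closed span of the backward shifts\<close>

lemma h2cspan_generator: "s \<in> S \<Longrightarrow> s \<in> h2cspan S"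
  unfolding h2cspan_def by (auto intro!: exI[of _ "{s}"] exI[of _ "\<lambda>_. 1"])

lemma h2cspan_cscale:
  assumes "g \<in> h2cspan S"
  shows "(\<lambda>\<gamma>. cscale c (g \<gamma>)) \<in> h2cspan S"
proof -
  obtain F d where F: "finite F" "F \<subseteq> S" "g = (\<lambda>\<beta>. \<Sum>h\<in>F. cscale (d h) (h \<beta>))"
    using assms unfolding h2cspan_def by auto
  then have "(\<lambda>\<gamma>. cscale c (g \<gamma>)) = (\<lambda>\<beta>. \<Sum>h\<in>F. cscale (c * d h) (h \<beta>))"
    by (simp add: cscale_sum_right cscale_cscale)
  then show ?thesis using F unfolding h2cspan_def
    by (auto intro!: exI[of _ F] exI[of _ "\<lambda>h. c * d h"])
qed

lemma h2cspan_add: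
  assumes "g \<in> h2cspan S" "g' \<in> h2cspan S"
  shows "(\<lambda>\<gamma>. g \<gamma> + g' \<gamma>) \<in> h2cspan S"
proof -
  obtain F d where F: "finite F" "F \<subseteq> S" "g = (\<lambda>\<beta>. \<Sum>h\<in>F. cscale (d h) (h \<beta>))"
    using assms unfolding h2cspan_def by auto
  obtain F' d' where F': "finite F'" "F' \<subseteq> S" "g' = (\<lambda>\<beta>. \<Sum>h\<in>F'. cscale (d' h) (h \<beta>))"
    using assms unfolding h2cspan_def by auto
  \<comment> \<open>Combinations are indexed by sets of functions, so one occurring in both
    \<open>F\<close> and \<open>F'\<close> receives the sum of its coefficients, with 0 as
    default.\<close>
  define e where "e h = (if h \<in> F then d h else 0) + (if h \<in> F' then d' h else 0)" for h
  have "g \<gamma> + g' \<gamma> = (\<Sum>h\<in>F \<union> F'. cscale (e h) (h \<gamma>))" for \<gamma>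
  proof -
    have "g \<gamma> = (\<Sum>h\<in>F \<union> F'. cscale (if h \<in> F then d h else 0) (h \<gamma>))"
      unfolding F(3) using F F' by (intro sum.mono_neutral_cong_left) auto
    moreover have "g' \<gamma> = (\<Sum>h\<in>F \<union> F'. cscale (if h \<in> F' then d' h else 0) (h \<gamma>))"
      unfolding F'(3) using F F' by (intro sum.mono_neutral_cong_left) auto
    ultimately show ?thesis by (simp add: e_def cscale_add_left sum.distrib)
  qed
  then show ?thesis using F F' unfolding h2cspan_def
    by (auto intro!: exI[of _ "F \<union> F'"] exI[of _ e])
qed

lemma h2cspan_shifts_subset_H2:
  assumes "f \<in> H2"
  shows "h2cspan (range (\<lambda>\<alpha>. bshift \<alpha> f)) \<subseteq> H2"
  using assms unfolding h2cspan_def by (auto intro!: H2_sum H2_cscale H2_bshift)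

lemma Ef_iff: "g \<in> Ef f \<longleftrightarrow> g \<in> H2 \<and>
  (\<forall>e>0. \<exists>h\<in>h2cspan (range (\<lambda>\<alpha>. bshift \<alpha> f)). h2sq (\<lambda>\<beta>. g \<beta> - h \<beta>) < e)"
proof -
  have *: "h2norm h < e \<longleftrightarrow> h2sq h < e\<^sup>2" if "e > 0" for e and h :: "('a \<Rightarrow> nat) \<Rightarrow> 'b"
    unfolding h2norm_def h2sq_def[symmetric]
    using that real_sqrt_less_iff[of "h2sq h" "e\<^sup>2"] by simp
  show ?thesis (is "_ \<longleftrightarrow> _ \<and> ?R")
  proof (intro iffI conjI)
    assume g: "g \<in> Ef f"
    then show "g \<in> H2" by (simp add: Ef_def)
    show ?R
    proof (intro allI impI)
      fix e :: real assume "e > 0"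
      with g have "\<exists>h\<in>h2cspan (range (\<lambda>\<alpha>. bshift \<alpha> f)). h2norm (\<lambda>\<beta>. g \<beta> - h \<beta>) < sqrt e"
        by (simp add: Ef_def)
      then show "\<exists>h\<in>h2cspan (range (\<lambda>\<alpha>. bshift \<alpha> f)). h2sq (\<lambda>\<beta>. g \<beta> - h \<beta>) < e"
        using *[of "sqrt e"] \<open>e > 0\<close> by auto
    qed
  next
    assume "g \<in> H2 \<and> ?R"
    then show "g \<in> Ef f" using * by (auto simp: Ef_def)
  qed
qed

lemma Ef_subset_H2: "Ef f \<subseteq> H2"
  by (auto simp: Ef_def)

text \<open>Taking the closure twice adds nothing. This permits approximation by arbitrary elements
  of \<open>Ef f\<close> instead of finite combinations of shifts.\<close>

lemma Ef_closed:
  assumes f: "f \<in> H2" and g: "g \<in> H2"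
    and approx: "\<And>e. e > 0 \<Longrightarrow> \<exists>h\<in>Ef f. h2sq (\<lambda>\<beta>. g \<beta> - h \<beta>) < e"
  shows "g \<in> Ef f"
  unfolding Ef_iff
proof (intro conjI g allI impI)
  fix e :: real assume "e > 0"
  \<comment> \<open>Two errors below \<open>e / 4\<close>, each doubled by \<open>H2_add\<close>,
    stay below \<open>e\<close>.\<close>
  obtain h where h: "h \<in> Ef f" "h2sq (\<lambda>\<beta>. g \<beta> - h \<beta>) < e / 4"
    using approx[of "e/4"] \<open>e > 0\<close> by auto
  obtain k where k: "k \<in> h2cspan (range (\<lambda>\<alpha>. bshift \<alpha> f))" "h2sq (\<lambda>\<beta>. h \<beta> - k \<beta>) < e / 4"
    using h(1) \<open>e > 0\<close> unfolding Ef_iff by (meson zero_less_divide_iff zero_less_numeral)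
  have "h \<in> H2" "k \<in> H2" using h k h2cspan_shifts_subset_H2[OF f] Ef_subset_H2 by auto
  then have "h2sq (\<lambda>\<beta>. (g \<beta> - h \<beta>) + (h \<beta> - k \<beta>)) \<le> 2 * h2sq (\<lambda>\<beta>. g \<beta> - h \<beta>) + 2 * h2sq (\<lambda>\<beta>. h \<beta> - k \<beta>)"
    using g by (intro H2_add H2_diff)
  then have "h2sq (\<lambda>\<beta>. g \<beta> - k \<beta>) < e" using h k by simp
  then show "\<exists>h\<in>h2cspan (range (\<lambda>\<alpha>. bshift \<alpha> f)). h2sq (\<lambda>\<beta>. g \<beta> - h \<beta>) < e"
    using k by blast
qed

lemma Ef_h2cspan:
  assumes "f \<in> H2" "g \<in> h2cspan (range (\<lambda>\<alpha>. bshift \<alpha> f))"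
  shows "g \<in> Ef f"
  unfolding Ef_iff using assms h2cspan_shifts_subset_H2[of f]
  by (auto intro!: bexI[of _ g] simp: h2sq_def)

lemma Ef_bshift: "f \<in> H2 \<Longrightarrow> bshift a f \<in> Ef f"
  by (intro Ef_h2cspan h2cspan_generator) auto

lemma Ef_add:
  assumes f: "f \<in> H2" and g: "g \<in> Ef f" and g': "g' \<in> Ef f"
  shows "(\<lambda>\<gamma>. g \<gamma> + g' \<gamma>) \<in> Ef f"
proof (rule Ef_closed[OF f])
  show "(\<lambda>\<gamma>. g \<gamma> + g' \<gamma>) \<in> H2" using g g' Ef_subset_H2 by (intro H2_add) auto
  fix e :: real assume "e > 0"
  then have e4: "e / 4 > 0" by simp
  obtain h where h: "h \<in> h2cspan (range (\<lambda>\<alpha>. bshift \<alpha> f))" "h2sq (\<lambda>\<beta>. g \<beta> - h \<beta>) < e / 4"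
    using g e4 unfolding Ef_iff by blast
  obtain h' where h': "h' \<in> h2cspan (range (\<lambda>\<alpha>. bshift \<alpha> f))" "h2sq (\<lambda>\<beta>. g' \<beta> - h' \<beta>) < e / 4"
    using g' e4 unfolding Ef_iff by blast
  have "h \<in> H2" "h' \<in> H2" "g \<in> H2" "g' \<in> H2"
    using h h' g g' h2cspan_shifts_subset_H2[OF f] Ef_subset_H2 by auto
  then have "h2sq (\<lambda>\<beta>. (g \<beta> - h \<beta>) + (g' \<beta> - h' \<beta>)) \<le> 2 * h2sq (\<lambda>\<beta>. g \<beta> - h \<beta>) + 2 * h2sq (\<lambda>\<beta>. g' \<beta> - h' \<beta>)"
    by (intro H2_add H2_diff)
  then have "h2sq (\<lambda>\<beta>. (g \<beta> + g' \<beta>) - (h \<beta> + h' \<beta>)) < e" using h h' by (simp add: add_diff_add)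
  then show "\<exists>h\<in>Ef f. h2sq (\<lambda>\<beta>. g \<beta> + g' \<beta> - h \<beta>) < e"
    using Ef_h2cspan[OF f h2cspan_add[OF h(1) h'(1)]] by auto
qed

lemma Ef_cscale:
  assumes f: "f \<in> H2" and g: "g \<in> Ef f"
  shows "(\<lambda>\<gamma>. cscale c (g \<gamma>)) \<in> Ef f"
proof (rule Ef_closed[OF f])
  show "(\<lambda>\<gamma>. cscale c (g \<gamma>)) \<in> H2" using g Ef_subset_H2 by (intro H2_cscale) auto
  fix e :: real assume "e > 0"
  \<comment> \<open>The added 1 keeps the denominator positive when \<open>c = 0\<close>.\<close>
  define e' where "e' = e / ((cmod c)\<^sup>2 + 1)"
  have "(cmod c)\<^sup>2 + 1 > 0" by (simp add: add_nonneg_pos)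
  then have "e' > 0" using \<open>e > 0\<close> by (simp add: e'_def)
  obtain h where h: "h \<in> h2cspan (range (\<lambda>\<alpha>. bshift \<alpha> f))" "h2sq (\<lambda>\<beta>. g \<beta> - h \<beta>) < e'"
    using g \<open>e' > 0\<close> unfolding Ef_iff by blast
  have "h \<in> H2" "g \<in> H2" using h g h2cspan_shifts_subset_H2[OF f] Ef_subset_H2 by auto
  then have "h2sq (\<lambda>\<beta>. cscale c (g \<beta> - h \<beta>)) = (cmod c)\<^sup>2 * h2sq (\<lambda>\<beta>. g \<beta> - h \<beta>)"
    by (intro H2_cscale H2_diff)
  also have "\<dots> \<le> (cmod c)\<^sup>2 * e'" using h by (intro mult_left_mono) auto
  also have "\<dots> < ((cmod c)\<^sup>2 + 1) * e'" using \<open>e' > 0\<close> by simp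
  also have "\<dots> = e" using \<open>(cmod c)\<^sup>2 + 1 > 0\<close> by (simp add: e'_def)
  finally have "h2sq (\<lambda>\<beta>. cscale c (g \<beta>) - cscale c (h \<beta>)) < e" by (simp add: cscale_diff_right)
  then show "\<exists>h\<in>Ef f. h2sq (\<lambda>\<beta>. cscale c (g \<beta>) - h \<beta>) < e"
    using Ef_h2cspan[OF f h2cspan_cscale[OF h(1)]] by auto
qed

lemma Ef_diff:
  assumes f: "f \<in> H2" and "g \<in> Ef f" "h \<in> Ef f"
  shows "(\<lambda>\<gamma>. g \<gamma> - h \<gamma>) \<in> Ef f"
  using Ef_add[OF f assms(2) Ef_cscale[OF f assms(3), of "-1"]] by (simp add: cscale_def)

lemma Ef_sum:
  assumes f: "f \<in> H2" and "\<And>i. i \<in> I \<Longrightarrow> g i \<in> Ef f"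
  shows "(\<lambda>\<gamma>. \<Sum>i\<in>I. g i \<gamma>) \<in> Ef f"
proof -
  \<comment> \<open>Covers the empty sum, and also an infinite \<open>I\<close>, over which the sum
    is 0 by convention.\<close>
  have "(\<lambda>\<gamma>. 0) \<in> Ef f"
    using Ef_cscale[OF f Ef_bshift[OF f], of 0] by simp
  then show ?thesis
    using assms(2) by (induction I rule: infinite_finite_induct) (auto intro: Ef_add[OF f])
qed

section \<open>Vectors all of whose monomials lie in the closed span\<close>

text \<open>The space \<open>Y\<close> of the overview. Asking for every \<beta> makes it possible
  to prove membership in \<open>Ef f\<close> coefficient by coefficient.\<close>

definition monomial_coeffs ::
    "(('m::finite \<Rightarrow> nat) \<Rightarrow> 'a::complex_hilbert) \<Rightarrow> 'a set" where
  "monomial_coeffs f = {x. \<forall>\<beta>. monomial \<beta> x \<in> Ef f}"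

lemma monomial_coeffs_add:
  assumes "f \<in> H2" "x \<in> monomial_coeffs f" "y \<in> monomial_coeffs f"
  shows "x + y \<in> monomial_coeffs f"
  using assms by (auto simp: monomial_coeffs_def monomial_add intro: Ef_add)

lemma monomial_coeffs_cscale:
  assumes "f \<in> H2" "x \<in> monomial_coeffs f"
  shows "cscale c x \<in> monomial_coeffs f"
  using assms by (auto simp: monomial_coeffs_def monomial_cscale intro: Ef_cscale)

lemma subspace_monomial_coeffs:
  assumes f: "f \<in> H2"
  shows "subspace (monomial_coeffs f)"
proof (rule subspaceI)
  have "(\<lambda>\<gamma>. \<Sum>i\<in>({}::nat set). f \<gamma>) \<in> Ef f" by (rule Ef_sum[OF f]) simp
  then show "0 \<in> monomial_coeffs f"
    by (simp add: monomial_coeffs_def monomial_def)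
qed (use f monomial_coeffs_add monomial_coeffs_cscale[of f _ "of_real _"] in \<open>auto simp: cscale_of_real\<close>)

text \<open>For fixed \<beta> the map from \<open>x\<close> to \<open>monomial \<beta> x\<close> is
  isometric, so closedness is inherited from \<open>Ef f\<close>.\<close>

lemma closed_monomial_coeffs:
  fixes f :: "('m::finite \<Rightarrow> nat) \<Rightarrow> 'a::complex_hilbert"
  assumes f: "f \<in> H2"
  shows "closed (monomial_coeffs f)"
proof -
  have "x \<in> monomial_coeffs f" if x: "x \<in> closure (monomial_coeffs f)" for x
    unfolding monomial_coeffs_def
  proof (intro CollectI allI Ef_closed[OF f H2_monomial])
    fix \<beta> :: "'m \<Rightarrow> nat" and e :: real assume "e > 0"
    then obtain y where y: "y \<in> monomial_coeffs f" "dist y x < sqrt e"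
      using x unfolding closure_approachable by (meson real_sqrt_gt_zero)
    have "(\<lambda>\<gamma>. monomial \<beta> x \<gamma> - monomial \<beta> y \<gamma>) = monomial \<beta> (x - y)"
      by (auto simp: monomial_def)
    then have "h2sq (\<lambda>\<gamma>. monomial \<beta> x \<gamma> - monomial \<beta> y \<gamma>) = (norm (x - y))\<^sup>2"
      by (simp add: h2sq_monomial)
    also have "\<dots> < (sqrt e)\<^sup>2"
      using y(2) by (intro power_strict_mono) (auto simp: dist_norm norm_minus_commute)
    finally show "\<exists>h\<in>Ef f. h2sq (\<lambda>\<gamma>. monomial \<beta> x \<gamma> - h \<gamma>) < e"
      using y(1) \<open>e > 0\<close> by (auto simp: monomial_coeffs_def)
  qed
  then show ?thesis by (metis closure_subset closure_eq subsetI subset_antisym)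
qed

text \<open>Finite truncations of \<open>g\<close> are sums of monomials in \<open>Ef f\<close>, and
  they converge to \<open>g\<close> because the squared norms are summable.\<close>

lemma Ef_if_values_in_monomial_coeffs:
  assumes f: "f \<in> H2" and g: "g \<in> H2" and val: "\<And>\<gamma>. g \<gamma> \<in> monomial_coeffs f"
  shows "g \<in> Ef f"
proof (rule Ef_closed[OF f g])
  fix e :: real assume "e > 0"
  have summ: "(\<lambda>\<gamma>. (norm (g \<gamma>))\<^sup>2) summable_on UNIV" using g by (simp add: H2_def)
  obtain F where F: "finite F" "dist (\<Sum>\<gamma>\<in>F. (norm (g \<gamma>))\<^sup>2) (h2sq g) < e"
    using infsum_finite_approximation[OF summ, of "e/2"] \<open>e > 0\<close> unfolding h2sq_def by force
  define h where "h = (\<lambda>\<gamma>. \<Sum>\<beta>\<in>F. monomial \<beta> (g \<beta>) \<gamma>)"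
  have h: "h \<gamma> = (if \<gamma> \<in> F then g \<gamma> else 0)" for \<gamma>
    unfolding h_def monomial_def using F(1) by simp
  have "h \<in> Ef f"
    unfolding h_def using val by (intro Ef_sum[OF f]) (auto simp: monomial_coeffs_def)
  moreover have "h2sq (\<lambda>\<gamma>. g \<gamma> - h \<gamma>) < e"
  proof -
    have "h2sq (\<lambda>\<gamma>. g \<gamma> - h \<gamma>) = infsum (\<lambda>\<gamma>. (norm (g \<gamma>))\<^sup>2) (UNIV - F)"
      unfolding h2sq_def by (rule infsum_cong_neutral) (auto simp: h)
    also have "\<dots> = h2sq g - (\<Sum>\<gamma>\<in>F. (norm (g \<gamma>))\<^sup>2)"
      unfolding h2sq_def using infsum_Diff[OF summ summable_on_finite[OF F(1)]] F(1) by simp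
    also have "\<dots> < e" using F(2) by (simp add: dist_real_def)
    finally show ?thesis .
  qed
  ultimately show "\<exists>h\<in>Ef f. h2sq (\<lambda>\<gamma>. g \<gamma> - h \<gamma>) < e" by blast
qed

section \<open>Averages of lacunary shifts\<close>

lemma gaps_at_top_imp_eventually_separated:
  fixes x :: "nat \<Rightarrow> int"
  assumes "filterlim (\<lambda>k. x (Suc k) - x k) at_top sequentially"
  shows "eventually (\<lambda>k. \<forall>j<k. B < x k - x j) sequentially"
proof -
  \<comment> \<open>The maximum with 1 makes \<open>x\<close> strictly increasing from
    \<open>K\<close> on, even for negative \<open>B\<close>.\<close>
  obtain K where K: "\<And>k. k \<ge> K \<Longrightarrow> max 1 (B + 1) \<le> x (Suc k) - x k"
    using assms unfolding filterlim_at_top eventually_sequentially by meson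
  have grow: "x j + max 1 (B + 1) + int (k - Suc j) \<le> x k" if "K \<le> j" "j < k" for j k
    using \<open>j < k\<close>
  proof (induction k)
    case (Suc k)
    have "max 1 (B + 1) \<le> x (Suc k) - x k" using Suc.prems that by (intro K) simp
    then show ?case using Suc by (cases "j = k") (auto simp: Suc_diff_le)
  qed simp
  define M where "M = Max (x ` {..K})"
  have M: "x j \<le> M" if "j \<le> K" for j unfolding M_def using that by (intro Max_ge) auto
  \<comment> \<open>The threshold on \<open>k\<close> forces \<open>x k > B + M\<close>, which deals
    with the initial terms bounded by \<open>M\<close>.\<close>
  have "B < x k - x j" if "j < k" "k \<ge> Suc K + nat (B + M - x K)" for j k
  proof (cases "K \<le> j")
    case True
    then show ?thesis using grow[of j k] that by linarith
  next
    case False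
    then show ?thesis using grow[of K k] M[of j] that by linarith
  qed
  then show ?thesis unfolding eventually_sequentially by blast
qed

text \<open>The tails decrease to 0. A block of terms that uses up more than half of the tail at
  \<open>N\<close> contributes more than 1/2 to the weighted series, since each denominator is at
  most the tail at \<open>N\<close>; this violates the Cauchy criterion.\<close>

lemma Abel_Dini_tail_divergence:
  fixes b :: "nat \<Rightarrow> real"
  assumes nonneg: "\<And>k. 0 \<le> b k" and summ: "summable b" and inf: "\<And>k. \<exists>j\<ge>k. b j \<noteq> 0"
  shows "0 < suminf b - sum b {..<k}"
    and "\<not> summable (\<lambda>k. b k / (suminf b - sum b {..<Suc k}))"
proof -
  \<comment> \<open>This tail still contains \<open>b k\<close>; the weights divide by
    \<open>T (Suc k)\<close>, the sum over \<open>j > k\<close>.\<close>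
  define T where "T k = suminf b - sum b {..<k}" for k
  have Tpos: "0 < T k" for k
  proof -
    obtain j where "j \<ge> k" "b j \<noteq> 0" using inf by blast
    then show ?thesis unfolding T_def
      using sum_less_suminf2[OF summ, of k j] nonneg by (simp add: order_less_le)
  qed
  then show "0 < suminf b - sum b {..<k}" by (simp add: T_def)
  have Tdec: "T n \<le> T k" if "k \<le> n" for k n
    unfolding T_def using sum_mono2[of "{..<n}" "{..<k}" b] that nonneg by auto
  have "T \<longlonglongrightarrow> suminf b - suminf b"
    unfolding T_def by (intro tendsto_intros summable_LIMSEQ[OF summ])
  then have T0: "T \<longlonglongrightarrow> 0" by simp
  show "\<not> summable (\<lambda>k. b k / (suminf b - sum b {..<Suc k}))"
  proof
    assume "summable (\<lambda>k. b k / (suminf b - sum b {..<Suc k}))"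
    then obtain N where N: "\<And>n. norm (sum (\<lambda>k. b k / T (Suc k)) {N..<n}) < 1/2"
      unfolding summable_Cauchy T_def by (metis half_gt_zero zero_less_one order_refl)
    have "eventually (\<lambda>n. T n < T N / 2) sequentially"
      using T0 Tpos[of N] by (intro order_tendstoD) auto
    then obtain n where n: "n \<ge> N" "T n < T N / 2"
      unfolding eventually_sequentially by (meson linorder_le_cases order_refl)
    have "T N - T n = (\<Sum>k=N..<n. b k)"
      using sum.atLeastLessThan_concat[of 0 N n b] n by (simp add: T_def lessThan_atLeast0)
    then have "1/2 < (\<Sum>k=N..<n. b k) / T N" using n Tpos[of N] by (simp add: field_simps)
    also have "\<dots> = (\<Sum>k=N..<n. b k / T N)" by (simp add: sum_divide_distrib)
    also have "\<dots> \<le> (\<Sum>k=N..<n. b k / T (Suc k))"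
      using Tpos Tdec nonneg by (intro sum_mono divide_left_mono mult_pos_pos) auto
    also have "\<dots> < 1/2" using N[of n] by auto
    finally show False .
  qed
qed

text \<open>If every point of \<open>K\<close> had a ball over which \<open>w\<close> is summable,
  finitely many such balls would cover \<open>K\<close> and \<open>w\<close> would be summable on
  \<open>A\<close>.\<close>

lemma compact_imp_divergence_point:
  fixes v :: "'i \<Rightarrow> 'a::metric_space" and w :: "'i \<Rightarrow> real"
  assumes K: "compact K" and v: "v ` A \<subseteq> K" and div: "\<not> w summable_on A"
  obtains u where "u \<in> K" "\<And>e. e > 0 \<Longrightarrow> \<not> w summable_on {k\<in>A. dist (v k) u < e}"
proof -
  have "\<exists>u\<in>K. \<forall>e>0. \<not> w summable_on {k\<in>A. dist (v k) u < e}"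
  proof (rule ccontr)
    assume "\<not> ?thesis"
    then obtain e where e: "\<And>u. u \<in> K \<Longrightarrow> e u > 0"
      "\<And>u. u \<in> K \<Longrightarrow> w summable_on {k\<in>A. dist (v k) u < e u}" by metis
    obtain D where D: "D \<subseteq> K" "finite D" "K \<subseteq> (\<Union>u\<in>D. ball u (e u))"
      by (rule compactE_image[OF K, of K "\<lambda>u. ball u (e u)"]) (use e in auto)
    have "w summable_on (\<Union>u\<in>D. {k\<in>A. dist (v k) u < e u})"
      using D(2,1) by (induction D) (auto intro: summable_on_union e(2))
    moreover have "A \<subseteq> (\<Union>u\<in>D. {k\<in>A. dist (v k) u < e u})"
      using D(3) v by (fastforce simp: dist_commute)
    ultimately show False using div summable_on_subset_banach by blast
  qed
  then show thesis using that by blast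
qed

text \<open>Cauchy-Schwarz applied to the nonzero terms only, so the constant is independent of the
  size of \<open>F\<close>.\<close>

lemma norm_sum_sq_le_card:
  fixes x :: "'i \<Rightarrow> 'a::real_normed_vector"
  assumes F: "finite F" and C: "card {k\<in>F. x k \<noteq> 0} \<le> C"
  shows "(norm (\<Sum>k\<in>F. x k))\<^sup>2 \<le> real C * (\<Sum>k\<in>F. (norm (x k))\<^sup>2)"
proof -
  define G where "G = {k\<in>F. x k \<noteq> 0}"
  have "(\<Sum>k\<in>F. x k) = (\<Sum>k\<in>G. x k)"
    unfolding G_def using F by (intro sum.mono_neutral_right) auto
  then have "(norm (\<Sum>k\<in>F. x k))\<^sup>2 \<le> (\<Sum>k\<in>G. norm (x k))\<^sup>2"
    by (simp add: norm_sum power_mono)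
  also have "\<dots> \<le> (\<Sum>k\<in>G. (norm (x k))\<^sup>2) * card G"
    by (rule sum_squared_le_sum_of_squares)
  also have "\<dots> \<le> (\<Sum>k\<in>F. (norm (x k))\<^sup>2) * C"
    using F C by (intro mult_mono sum_mono2) (auto simp: G_def intro: sum_nonneg)
  finally show ?thesis by (simp add: mult.commute)
qed

text \<open>Bounded overlap substitutes for orthogonality of the summands: the pointwise estimate is
  summed over all multi-indices.\<close>

lemma h2sq_sum_bounded_overlap:
  assumes F: "finite F" and r: "\<And>k. k \<in> F \<Longrightarrow> r k \<in> H2"
    and C: "\<And>\<gamma>. card {k\<in>F. r k \<gamma> \<noteq> 0} \<le> C"
  shows "h2sq (\<lambda>\<gamma>. \<Sum>k\<in>F. r k \<gamma>) \<le> real C * (\<Sum>k\<in>F. h2sq (r k))"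
proof -
  have hs: "((\<lambda>\<gamma>. \<Sum>k\<in>F. (norm (r k \<gamma>))\<^sup>2) has_sum (\<Sum>k\<in>F. h2sq (r k))) UNIV"
    unfolding h2sq_def using F r
    by (induction F) (auto simp: H2_def intro!: has_sum_add has_sum_infsum)
  have "h2sq (\<lambda>\<gamma>. \<Sum>k\<in>F. r k \<gamma>) \<le> (\<Sum>\<^sub>\<infinity>\<gamma>. real C * (\<Sum>k\<in>F. (norm (r k \<gamma>))\<^sup>2))"
    using has_sum_imp_summable[OF hs] F C
    by (intro H2_dominated summable_on_cmult_right norm_sum_sq_le_card) auto
  also have "\<dots> = real C * (\<Sum>k\<in>F. h2sq (r k))"
    using has_sum_cmult_right[OF hs] by (rule infsumI)
  finally show ?thesis .
qed

section \<open>Remainders of shifts and their averages\<close>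

text \<open>A nonzero coefficient at \<gamma> comes from some \<open>\<alpha> j\<close>. The case
  \<open>j < k\<close> would make a coordinate of \<gamma> negative by \<open>sep\<close>, and
  \<open>j = k\<close> would give \<open>\<gamma> = \<beta>\<close>.\<close>

lemma bshift_remainder_index:
  fixes \<alpha> :: "nat \<Rightarrow> ('m::finite \<Rightarrow> nat)"
  assumes supp: "spec g \<subseteq> range \<alpha>" and le: "\<And>i. \<beta> i \<le> \<alpha> k i"
    and sep: "\<And>j. j < k \<Longrightarrow> \<exists>i. int (\<beta> i) < int (\<alpha> k i) - int (\<alpha> j i)"
    and nz: "bshift (\<lambda>i. \<alpha> k i - \<beta> i) g \<gamma> \<noteq> 0" and ne: "\<gamma> \<noteq> \<beta>"
  obtains j where "k < j" "\<alpha> j = (\<lambda>i. \<alpha> k i - \<beta> i + \<gamma> i)"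
proof -
  obtain j where j: "\<alpha> j = (\<lambda>i. \<alpha> k i - \<beta> i + \<gamma> i)"
    using nz supp by (fastforce simp: bshift_def spec_def)
  \<comment> \<open>By \<open>le\<close> the subtraction of natural numbers is not
    truncated.\<close>
  have "int (\<alpha> k i) - int (\<alpha> j i) = int (\<beta> i) - int (\<gamma> i)" for i
    using le[of i] by (simp add: j)
  then have "\<not> j < k" using sep[of j] by force
  moreover have "j \<noteq> k"
  proof
    assume "j = k"
    have "\<gamma> i = \<beta> i" for i using le[of i] fun_cong[OF j, of i] by (simp add: \<open>j = k\<close>)
    then show False using ne by auto
  qed
  ultimately show thesis using that j by (meson linorder_neqE_nat)
qed

text \<open>Distinct multi-indices in the support of the remainder come from distinct
  \<open>j > k\<close>, so its squared norm is at most the tail beyond \<open>k\<close>.\<close>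

lemma h2sq_bshift_remainder:
  fixes \<alpha> :: "nat \<Rightarrow> ('m::finite \<Rightarrow> nat)"
  assumes g: "g \<in> H2" and inj: "inj \<alpha>" and supp: "spec g \<subseteq> range \<alpha>"
    and summ: "summable (\<lambda>j. (norm (g (\<alpha> j)))\<^sup>2)" and le: "\<And>i. \<beta> i \<le> \<alpha> k i"
    and sep: "\<And>j. j < k \<Longrightarrow> \<exists>i. int (\<beta> i) < int (\<alpha> k i) - int (\<alpha> j i)"
  defines "r \<equiv> \<lambda>\<gamma>. if \<gamma> = \<beta> then 0 else bshift (\<lambda>i. \<alpha> k i - \<beta> i) g \<gamma>"
  shows "r \<in> H2"
    and "h2sq r \<le> (\<Sum>j. (norm (g (\<alpha> j)))\<^sup>2) - (\<Sum>j<Suc k. (norm (g (\<alpha> j)))\<^sup>2)"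
proof -
  have "(\<lambda>\<gamma>. (norm (bshift (\<lambda>i. \<alpha> k i - \<beta> i) g \<gamma>))\<^sup>2) summable_on UNIV"
    using H2_bshift[OF g] by (simp add: H2_def)
  then show rH: "r \<in> H2"
    by (rule H2_dominated) (simp add: r_def)
  show "h2sq r \<le> (\<Sum>j. (norm (g (\<alpha> j)))\<^sup>2) - (\<Sum>j<Suc k. (norm (g (\<alpha> j)))\<^sup>2)"
    unfolding h2sq_def
  proof (rule infsum_le_finite_sums)
    show "(\<lambda>\<gamma>. (norm (r \<gamma>))\<^sup>2) summable_on UNIV" using rH by (simp add: H2_def)
    fix G :: "('m \<Rightarrow> nat) set" assume G: "finite G"
    define G' where "G' = {\<gamma>\<in>G. r \<gamma> \<noteq> 0}"
    have "\<exists>j. k < j \<and> \<alpha> j = (\<lambda>i. \<alpha> k i - \<beta> i + \<gamma> i)" if "\<gamma> \<in> G'" for \<gamma>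
      using that bshift_remainder_index[where g=g and \<alpha>=\<alpha> and k=k and \<beta>=\<beta> and \<gamma>=\<gamma>, OF supp le sep]
      by (auto simp: G'_def r_def split: if_splits)
    then obtain J where J: "\<And>\<gamma>. \<gamma> \<in> G' \<Longrightarrow> k < J \<gamma>"
      "\<And>\<gamma>. \<gamma> \<in> G' \<Longrightarrow> \<alpha> (J \<gamma>) = (\<lambda>i. \<alpha> k i - \<beta> i + \<gamma> i)" by metis
    have Jinj: "inj_on J G'"
    proof (rule inj_onI)
      fix \<gamma> \<gamma>' assume "\<gamma> \<in> G'" "\<gamma>' \<in> G'" "J \<gamma> = J \<gamma>'"
      then have "(\<lambda>i. \<alpha> k i - \<beta> i + \<gamma> i) = (\<lambda>i. \<alpha> k i - \<beta> i + \<gamma>' i)" using J(2) by metis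
      then show "\<gamma> = \<gamma>'" by (simp add: fun_eq_iff)
    qed
    have finG': "finite G'" using G by (simp add: G'_def)
    have "(\<Sum>\<gamma>\<in>G. (norm (r \<gamma>))\<^sup>2) = (\<Sum>\<gamma>\<in>G'. (norm (r \<gamma>))\<^sup>2)"
      unfolding G'_def using G by (intro sum.mono_neutral_right) auto
    also have "\<dots> = (\<Sum>\<gamma>\<in>G'. (norm (g (\<alpha> (J \<gamma>))))\<^sup>2)"
      using J(2) by (intro sum.cong) (auto simp: G'_def r_def bshift_def)
    also have "\<dots> = (\<Sum>j\<in>J ` G'. (norm (g (\<alpha> j)))\<^sup>2)"
      by (simp add: sum.reindex[OF Jinj])
    \<comment> \<open>The image of \<open>J\<close> lies beyond \<open>k\<close>, so both sums merge
      into one finite part of the full series.\<close>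
    finally have "(\<Sum>\<gamma>\<in>G. (norm (r \<gamma>))\<^sup>2) + (\<Sum>j<Suc k. (norm (g (\<alpha> j)))\<^sup>2)
        = (\<Sum>j\<in>J ` G' \<union> {..<Suc k}. (norm (g (\<alpha> j)))\<^sup>2)"
      using finG' J(1) by (subst sum.union_disjoint) (auto, force)
    also have "\<dots> \<le> (\<Sum>j. (norm (g (\<alpha> j)))\<^sup>2)"
      using finG' by (intro sum_le_suminf summ) auto
    finally show "(\<Sum>\<gamma>\<in>G. (norm (r \<gamma>))\<^sup>2)
        \<le> (\<Sum>j. (norm (g (\<alpha> j)))\<^sup>2) - (\<Sum>j<Suc k. (norm (g (\<alpha> j)))\<^sup>2)" by simp
  qed
qed

lemma not_summable_on_imp_large_finite_sum:
  fixes w :: "'i \<Rightarrow> real"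
  assumes "\<And>k. k \<in> A \<Longrightarrow> 0 \<le> w k" "\<not> w summable_on A"
  obtains F where "finite F" "F \<subseteq> A" "M < sum w F"
proof -
  have "\<not> bdd_above (sum w ` {F. F \<subseteq> A \<and> finite F})"
    using assms nonneg_bdd_above_summable_on by blast
  then show thesis using that unfolding bdd_above_def by (auto simp: not_le)
qed

text \<open>The error splits into a monomial at \<beta>, small because the chosen directions are
  close to \<open>u\<close>, and a remainder, small by bounded overlap and large total weight. Each
  gets \<open>e / 4\<close>, which \<open>H2_add\<close> doubles.\<close>

lemma monomial_in_Ef_if_divergence_point:
  fixes g :: "('m::finite \<Rightarrow> nat) \<Rightarrow> 'a::complex_hilbert"
  assumes f: "f \<in> H2" and g: "g \<in> H2" and shifts: "\<And>a. bshift a g \<in> Ef f"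
    and inj: "inj \<alpha>" and supp: "spec g \<subseteq> range \<alpha>"
    and overlap: "\<And>\<delta>. finite {k. \<exists>j. j \<noteq> k \<and> (\<forall>i. int (\<alpha> j i) - int (\<alpha> k i) = \<delta> i)} \<and>
      card {k. \<exists>j. j \<noteq> k \<and> (\<forall>i. int (\<alpha> j i) - int (\<alpha> k i) = \<delta> i)} \<le> C"
    and gaps: "\<And>i. filterlim (\<lambda>k. int (\<alpha> (Suc k) i) - int (\<alpha> k i)) at_top sequentially"
    and summ: "summable (\<lambda>k. (norm (g (\<alpha> k)))\<^sup>2)"
  defines "T \<equiv> \<lambda>k. (\<Sum>j. (norm (g (\<alpha> j)))\<^sup>2) - (\<Sum>j<Suc k. (norm (g (\<alpha> j)))\<^sup>2)"
  assumes Tpos: "\<And>k. 0 < T k"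
    and div: "\<And>e. e > 0 \<Longrightarrow> \<not> (\<lambda>k. (norm (g (\<alpha> k)))\<^sup>2 / T k) summable_on
      {k. g (\<alpha> k) \<noteq> 0 \<and> dist ((1 / norm (g (\<alpha> k))) *\<^sub>R g (\<alpha> k)) u < e}"
  shows "monomial \<beta> u \<in> Ef f"
proof (rule Ef_closed[OF f H2_monomial])
  fix e :: real assume "e > 0"
  define w where "w k = (norm (g (\<alpha> k)))\<^sup>2 / T k" for k
  define v where "v k = (1 / norm (g (\<alpha> k))) *\<^sub>R g (\<alpha> k)" for k
  have "eventually (\<lambda>k. \<forall>i. \<forall>j<k. int (\<beta> i) < int (\<alpha> k i) - int (\<alpha> j i)) sequentially"
    using gaps_at_top_imp_eventually_separated[OF gaps]
    by (intro eventually_all_finite) blast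
  then obtain K where K: "\<And>k i j. k \<ge> K \<Longrightarrow> j < k \<Longrightarrow> int (\<beta> i) < int (\<alpha> k i) - int (\<alpha> j i)"
    unfolding eventually_sequentially by blast
  define A where "A = {k. g (\<alpha> k) \<noteq> 0 \<and> dist (v k) u < sqrt (e / 4)}"
  have "\<not> w summable_on A"
    using div[of "sqrt (e / 4)"] \<open>e > 0\<close> by (simp add: A_def v_def w_def[abs_def])
  \<comment> \<open>Dropping finitely many indices preserves divergence.\<close>
  moreover have "w summable_on (A - {..K}) \<Longrightarrow> w summable_on A"
    using summable_on_union[of w "A - {..K}" "A \<inter> {..K}"] by (simp add: Un_Diff_Int)
  ultimately have "\<not> w summable_on (A - {..K})" by blast
  moreover have "0 \<le> w k" for k using Tpos[of k] by (simp add: w_def)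
  \<comment> \<open>The bound yields \<open>real C / W < e / 4\<close>; the added 1 keeps
    \<open>W\<close> positive when \<open>C = 0\<close>.\<close>
  ultimately obtain F where F: "finite F" "F \<subseteq> A - {..K}" and W: "4 * real C / e + 1 < sum w F"
    using not_summable_on_imp_large_finite_sum by metis
  define W where "W = sum w F"
  have "W > 0" using W \<open>e > 0\<close> unfolding W_def
    by (smt (verit) divide_nonneg_pos of_nat_0_le_iff mult_nonneg_nonneg)
  have CW: "4 * real C < e * W" using W \<open>e > 0\<close> unfolding W_def by (simp add: field_simps)
  have nz: "g (\<alpha> k) \<noteq> 0" and near: "norm (v k - u) \<le> sqrt (e / 4)" if "k \<in> F" for k
    using that F by (auto simp: A_def dist_norm)
  have wpos: "w k > 0" if "k \<in> F" for k using nz[OF that] Tpos[of k] by (simp add: w_def)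
  \<comment> \<open>With this scaling the coefficient at \<beta> is a convex combination of the unit
    vectors \<open>v k\<close>, while \<open>(\<mu> k)\<^sup>2 * T k = w k / W\<^sup>2\<close>;
    summed over \<open>F\<close>, the latter gives \<open>1 / W\<close>.\<close>
  define \<mu> where "\<mu> k = w k / W / norm (g (\<alpha> k))" for k
  define s where "s k = bshift (\<lambda>i. \<alpha> k i - \<beta> i) g" for k
  define r where "r k = (\<lambda>\<gamma>. if \<gamma> = \<beta> then 0 else s k \<gamma>)" for k
  \<comment> \<open>Comparison with index 0 suffices, since \<open>k > K\<close> ensures
    \<open>0 < k\<close>.\<close>
  have le: "\<beta> i \<le> \<alpha> k i" if "k \<in> F" for i k
    using K[of k 0 i] that F by force
  have sep: "\<exists>i. int (\<beta> i) < int (\<alpha> k i) - int (\<alpha> j i)" if "k \<in> F" "j < k" for j k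
    using K[of k j] that F by force
  have s\<beta>: "s k \<beta> = g (\<alpha> k)" if "k \<in> F" for k
    using le[OF that] by (simp add: s_def bshift_def)
  have rH: "r k \<in> H2" and rT: "h2sq (r k) \<le> T k" if "k \<in> F" for k
    unfolding r_def s_def T_def
    by (rule h2sq_bshift_remainder[OF g inj supp summ le[OF that] sep[OF that]], assumption)+
  define h where "h = (\<lambda>\<gamma>. \<Sum>k\<in>F. cscale (of_real (\<mu> k)) (s k \<gamma>))"
  define R where "R = (\<lambda>\<gamma>. \<Sum>k\<in>F. cscale (of_real (\<mu> k)) (r k \<gamma>))"
  define d where "d = (\<Sum>k\<in>F. (w k / W) *\<^sub>R (u - v k))"
  have "h \<in> Ef f"
    unfolding h_def s_def by (intro Ef_sum[OF f] Ef_cscale[OF f] shifts)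
  have sumw: "(\<Sum>k\<in>F. w k / W) = 1"
    using \<open>W > 0\<close> by (simp add: sum_divide_distrib[symmetric] W_def)
  \<comment> \<open>At \<beta> only the averaged deviation \<open>d\<close> remains; elsewhere the
    target vanishes and only the remainder \<open>R\<close> is left.\<close>
  have split: "monomial \<beta> u \<gamma> - h \<gamma> = monomial \<beta> d \<gamma> + cscale (-1) (R \<gamma>)" for \<gamma>
  proof (cases "\<gamma> = \<beta>")
    case True
    have "d = (\<Sum>k\<in>F. w k / W) *\<^sub>R u - (\<Sum>k\<in>F. (w k / W) *\<^sub>R v k)"
      by (simp add: d_def scaleR_diff_right sum_subtractf scaleR_sum_left)
    also have "(\<Sum>k\<in>F. (w k / W) *\<^sub>R v k) = h \<beta>"
      unfolding h_def by (intro sum.cong) (simp_all only: s\<beta> v_def \<mu>_def cscale_of_real, simp)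
    finally have "d = u - h \<beta>" by (simp add: sumw)
    moreover have "R \<beta> = 0" by (simp add: R_def r_def)
    ultimately show ?thesis using True by (simp add: monomial_def)
  next
    case False
    then show ?thesis by (simp add: monomial_def h_def R_def r_def cscale_def sum_negf)
  qed
  have RH: "R \<in> H2" unfolding R_def by (intro H2_sum H2_cscale rH)
  have "norm d \<le> (\<Sum>k\<in>F. (w k / W) * sqrt (e / 4))"
    unfolding d_def
  proof (rule sum_norm_le)
    fix k assume "k \<in> F"
    then show "norm ((w k / W) *\<^sub>R (u - v k)) \<le> w k / W * sqrt (e / 4)"
      using near[of k] wpos[of k] \<open>W > 0\<close>
      by (auto simp: norm_minus_commute intro!: mult_left_mono divide_right_mono)
  qed
  also have "\<dots> = sqrt (e / 4)" by (simp only: sum_distrib_right[symmetric] sumw mult_1)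
  finally have "(norm d)\<^sup>2 \<le> (sqrt (e / 4))\<^sup>2" by (intro power_mono) auto
  then have d: "h2sq (monomial \<beta> d) \<le> e / 4" using \<open>e > 0\<close> by (simp add: h2sq_monomial)
  have "h2sq R \<le> real C * (\<Sum>k\<in>F. h2sq (\<lambda>\<gamma>. cscale (of_real (\<mu> k)) (r k \<gamma>)))"
    unfolding R_def
  proof (rule h2sq_sum_bounded_overlap[OF F(1)])
    show "(\<lambda>\<gamma>. cscale (of_real (\<mu> k)) (r k \<gamma>)) \<in> H2" if "k \<in> F" for k
      using that by (intro H2_cscale rH)
    fix \<gamma>
    \<comment> \<open>Each remainder that is nonzero at \<gamma> yields a pair of spectral points
      with difference \<open>\<gamma> - \<beta>\<close>; this is where the difference count
      enters.\<close>
    let ?D = "{k. \<exists>j. j \<noteq> k \<and> (\<forall>i. int (\<alpha> j i) - int (\<alpha> k i) = int (\<gamma> i) - int (\<beta> i))}"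
    have "k \<in> ?D" if k: "k \<in> F" and "cscale (of_real (\<mu> k)) (r k \<gamma>) \<noteq> 0" for k
    proof -
      have "\<gamma> \<noteq> \<beta>" "bshift (\<lambda>i. \<alpha> k i - \<beta> i) g \<gamma> \<noteq> 0"
        using that by (auto simp: r_def s_def split: if_splits)
      then obtain j where j: "k < j" "\<alpha> j = (\<lambda>i. \<alpha> k i - \<beta> i + \<gamma> i)"
        using bshift_remainder_index[OF supp le[OF k] sep[OF k]] by metis
      have "int (\<alpha> j i) - int (\<alpha> k i) = int (\<gamma> i) - int (\<beta> i)" for i
        using le[OF k, of i] by (simp add: j(2))
      then show ?thesis using j(1) by (intro CollectI exI[of _ j]) simp
    qed
    then have "{k\<in>F. cscale (of_real (\<mu> k)) (r k \<gamma>) \<noteq> 0} \<subseteq> ?D" by blast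
    then show "card {k\<in>F. cscale (of_real (\<mu> k)) (r k \<gamma>) \<noteq> 0} \<le> C"
      using overlap[of "\<lambda>i. int (\<gamma> i) - int (\<beta> i)"] card_mono order_trans by meson
  qed
  also have "(\<Sum>k\<in>F. h2sq (\<lambda>\<gamma>. cscale (of_real (\<mu> k)) (r k \<gamma>))) \<le> (\<Sum>k\<in>F. w k / W\<^sup>2)"
  proof (rule sum_mono)
    fix k assume k: "k \<in> F"
    have "h2sq (\<lambda>\<gamma>. cscale (of_real (\<mu> k)) (r k \<gamma>)) = (\<mu> k)\<^sup>2 * h2sq (r k)"
      by (simp add: H2_cscale(2)[OF rH[OF k]])
    also have "\<dots> \<le> (\<mu> k)\<^sup>2 * T k" by (intro mult_left_mono rT k) simp
    also have "\<dots> = w k / W\<^sup>2"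
      using nz[OF k] Tpos[of k] \<open>W > 0\<close>
      by (simp add: \<mu>_def w_def power_divide field_simps power2_eq_square)
    finally show "h2sq (\<lambda>\<gamma>. cscale (of_real (\<mu> k)) (r k \<gamma>)) \<le> w k / W\<^sup>2" .
  qed
  also have "(\<Sum>k\<in>F. w k / W\<^sup>2) = 1 / W"
    using \<open>W > 0\<close> by (simp add: sum_divide_distrib[symmetric] W_def[symmetric] power2_eq_square)
  finally have "h2sq R \<le> real C / W" by (simp add: mult_left_mono)
  also have "\<dots> < e / 4" using CW \<open>W > 0\<close> by (simp add: field_simps)
  finally have R: "h2sq R < e / 4" .
  have "h2sq (\<lambda>\<gamma>. monomial \<beta> u \<gamma> - h \<gamma>)
      \<le> 2 * h2sq (monomial \<beta> d) + 2 * h2sq (\<lambda>\<gamma>. cscale (-1) (R \<gamma>))"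
    unfolding split by (intro H2_add H2_monomial H2_cscale RH)
  also have "h2sq (\<lambda>\<gamma>. cscale (-1) (R \<gamma>)) = h2sq R"
    by (simp add: H2_cscale(2)[OF RH])
  finally have "h2sq (\<lambda>\<gamma>. monomial \<beta> u \<gamma> - h \<gamma>) < e" using d R by simp
  then show "\<exists>h\<in>Ef f. h2sq (\<lambda>\<gamma>. monomial \<beta> u \<gamma> - h \<gamma>) < e"
    using \<open>h \<in> Ef f\<close> by blast
qed

section \<open>The two implications\<close>

text \<open>Translates (C1) from pairs to indices: each such \<open>k\<close> is recovered from the
  second entry of a pair. Finiteness is carried along because \<open>card\<close> is 0 on infinite
  sets.\<close>

lemma overlap_of_difference_count:
  fixes \<alpha> :: "nat \<Rightarrow> ('m \<Rightarrow> nat)" and \<delta> :: "'m \<Rightarrow> int"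
  assumes inj: "inj \<alpha>"
  defines "D \<equiv> {(a, a'). a \<in> range \<alpha> \<and> a' \<in> range \<alpha> \<and> a \<noteq> a' \<and> (\<forall>i. int (a i) - int (a' i) = \<delta> i)}"
  assumes fin: "finite D" and card: "card D \<le> C"
  shows "finite {k. \<exists>j. j \<noteq> k \<and> (\<forall>i. int (\<alpha> j i) - int (\<alpha> k i) = \<delta> i)} \<and>
    card {k. \<exists>j. j \<noteq> k \<and> (\<forall>i. int (\<alpha> j i) - int (\<alpha> k i) = \<delta> i)} \<le> C" (is "finite ?L \<and> _")
proof -
  have sub: "?L \<subseteq> (\<lambda>(a, a'). inv \<alpha> a') ` D"
  proof
    fix k assume "k \<in> ?L"
    then obtain j where "j \<noteq> k" "\<forall>i. int (\<alpha> j i) - int (\<alpha> k i) = \<delta> i" by blast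
    then have "(\<alpha> j, \<alpha> k) \<in> D" using inj by (auto simp: D_def inj_eq)
    then show "k \<in> (\<lambda>(a, a'). inv \<alpha> a') ` D"
      using inj by (intro image_eqI[of _ _ "(\<alpha> j, \<alpha> k)"]) simp_all
  qed
  then have "card ?L \<le> card ((\<lambda>(a, a'). inv \<alpha> a') ` D)"
    by (intro card_mono finite_imageI fin)
  also have "\<dots> \<le> card D" by (rule card_image_le[OF fin])
  finally show ?thesis using card finite_subset[OF sub] fin by simp
qed

text \<open>Evaluation at one multi-index is contractive, so approximants of
  \<open>monomial \<beta> x\<close> give approximants \<open>h \<beta>\<close> of
  \<open>x\<close>.\<close>

lemma cyclic_imp_tail_span_dense:
  fixes f :: "('m::finite \<Rightarrow> nat) \<Rightarrow> 'a::complex_hilbert" and \<alpha> :: "nat \<Rightarrow> ('m \<Rightarrow> nat)"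
  assumes f: "f \<in> H2" and cyc: "cyclic f" and supp: "spec f \<subseteq> range \<alpha>"
  shows "closure (cspan {f (\<alpha> j) | j. j \<ge> k}) = UNIV"
proof -
  \<comment> \<open>This exceeds \<open>\<alpha> j\<close> in every coordinate for all
    \<open>j < k\<close>, so no shift can bring an early coefficient to position \<beta>.\<close>
  define \<beta> :: "'m \<Rightarrow> nat" where "\<beta> i = Suc (\<Sum>j<k. \<alpha> j i)" for i
  have big: "\<alpha> j i < \<beta> i" if "j < k" for i j
    unfolding \<beta>_def less_Suc_eq_le by (rule member_le_sum) (use that in auto)
  have tail: "h \<beta> \<in> cspan {f (\<alpha> j) | j. j \<ge> k}"
    if h: "h \<in> h2cspan (range (\<lambda>a. bshift a f))" for h
  proof -
    obtain F c where F: "finite F" "F \<subseteq> range (\<lambda>a. bshift a f)"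
      "h = (\<lambda>\<gamma>. \<Sum>s\<in>F. cscale (c s) (s \<gamma>))"
      using h unfolding h2cspan_def by auto
    have val: "s \<beta> = 0 \<or> s \<beta> \<in> {f (\<alpha> j) | j. j \<ge> k}" if s: "s \<in> F" for s
    proof -
      obtain a where a: "s = bshift a f" using s F(2) by blast
      show ?thesis
      proof (cases "s \<beta> = 0")
        case False
        then obtain j where j: "\<alpha> j = (\<lambda>i. a i + \<beta> i)"
          using supp by (fastforce simp: a bshift_def spec_def)
        have "\<not> j < k" using big[of j] fun_cong[OF j] by (metis not_add_less2)
        then show ?thesis using j by (auto simp: a bshift_def intro!: exI[of _ j])
      qed simp
    qed
    define V where "V = (\<lambda>s. s \<beta>) ` {s\<in>F. s \<beta> \<noteq> 0}"
    \<comment> \<open>\<open>cspan\<close> has one scalar per vector, so shifts with the same value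
      at \<beta> are grouped and their scalars added.\<close>
    define d where "d x = (\<Sum>s\<in>{s\<in>{s\<in>F. s \<beta> \<noteq> 0}. s \<beta> = x}. c s)" for x
    have cs: "cscale (\<Sum>s\<in>S. c s) x = (\<Sum>s\<in>S. cscale (c s) x)" for S x
      by (induction S rule: infinite_finite_induct) (simp_all add: cscale_add_left)
    have "h \<beta> = (\<Sum>s\<in>{s\<in>F. s \<beta> \<noteq> 0}. cscale (c s) (s \<beta>))"
      unfolding F(3) using F(1) by (intro sum.mono_neutral_right) auto
    also have "\<dots> = (\<Sum>x\<in>V. \<Sum>s\<in>{s\<in>{s\<in>F. s \<beta> \<noteq> 0}. s \<beta> = x}. cscale (c s) (s \<beta>))"
      unfolding V_def using F(1) by (intro sum.image_gen) auto
    also have "\<dots> = (\<Sum>x\<in>V. cscale (d x) x)"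
      unfolding d_def cs by (intro sum.cong) auto
    finally have "h \<beta> = (\<Sum>x\<in>V. cscale (d x) x)" .
    moreover have "finite V" "V \<subseteq> {f (\<alpha> j) | j. j \<ge> k}"
      using F(1) val by (auto simp: V_def)
    ultimately show ?thesis unfolding cspan_def by blast
  qed
  have "x \<in> closure (cspan {f (\<alpha> j) | j. j \<ge> k})" for x
    unfolding closure_approachable
  proof (intro allI impI)
    fix e :: real assume "e > 0"
    have "monomial \<beta> x \<in> Ef f" using cyc H2_monomial by (auto simp: cyclic_def)
    then obtain h where h: "h \<in> h2cspan (range (\<lambda>a. bshift a f))"
      "h2sq (\<lambda>\<gamma>. monomial \<beta> x \<gamma> - h \<gamma>) < e\<^sup>2"
      using \<open>e > 0\<close> unfolding Ef_iff by (meson zero_less_power)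
    have "h \<in> H2" using h(1) h2cspan_shifts_subset_H2[OF f] by auto
    then have "(norm (x - h \<beta>))\<^sup>2 \<le> h2sq (\<lambda>\<gamma>. monomial \<beta> x \<gamma> - h \<gamma>)"
      using norm_le_h2sq[OF H2_diff[OF H2_monomial], of h \<beta> x \<beta>] by (simp add: monomial_def)
    with h(2) have "(norm (x - h \<beta>))\<^sup>2 < e\<^sup>2" by simp
    then have "dist (h \<beta>) x < e"
      using \<open>e > 0\<close> by (simp add: dist_norm norm_minus_commute power2_less_imp_less)
    then show "\<exists>y\<in>cspan {f (\<alpha> j) | j. j \<ge> k}. dist y x < e" using tail[OF h(1)] by blast
  qed
  then show ?thesis by blast
qed

text \<open>It suffices that \<open>monomial_coeffs f\<close> is the whole space, because then every
  element of \<open>H2\<close> takes its values there.\<close>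

lemma tail_span_dense_imp_cyclic:
  fixes f :: "('m::finite \<Rightarrow> nat) \<Rightarrow> 'a::complex_hilbert"
  assumes f: "f \<in> H2" and inj: "inj \<alpha>" and supp: "spec f \<subseteq> range \<alpha>"
    and overlap: "\<And>\<delta>. finite {k. \<exists>j. j \<noteq> k \<and> (\<forall>i. int (\<alpha> j i) - int (\<alpha> k i) = \<delta> i)} \<and>
      card {k. \<exists>j. j \<noteq> k \<and> (\<forall>i. int (\<alpha> j i) - int (\<alpha> k i) = \<delta> i)} \<le> C"
    and gaps: "\<And>i. filterlim (\<lambda>k. int (\<alpha> (Suc k) i) - int (\<alpha> k i)) at_top sequentially"
    and crc: "completely_rel_compact (\<lambda>k. f (\<alpha> k))"
    and dense: "\<And>k. closure (cspan {f (\<alpha> j) | j. j \<ge> k}) = UNIV"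
  shows "cyclic f"
proof -
  let ?Y = "monomial_coeffs f"
  note sub = subspace_monomial_coeffs[OF f] and cl = closed_monomial_coeffs[OF f]
  have Yc: "cscale c x \<in> ?Y" if "x \<in> ?Y" for c x
    using monomial_coeffs_cscale[OF f that] .
  obtain P where P: "orth_proj P" and PY: "\<And>x. x - P x \<in> ?Y" and P0: "\<And>x. x \<in> ?Y \<Longrightarrow> P x = 0"
    by (rule orth_proj_complement_exists[OF sub cl]) (use Yc[of _ \<i>] in \<open>auto simp: cscale_ii\<close>)
  have Plin: "bounded_linear P" and PP: "\<And>x. P (P x) = P x"
    using P by (auto simp: orth_proj_def)
  interpret P: bounded_linear P by fact
  have Ple: "(norm (P x))\<^sup>2 \<le> (onorm P)\<^sup>2 * (norm x)\<^sup>2" for x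
    using power_mono[OF onorm[OF Plin, of x], of 2] by (simp add: power_mult_distrib)
  define g where "g = (\<lambda>\<gamma>. P (f \<gamma>))"
  have g: "g \<in> H2"
  proof (rule H2_dominated)
    show "(\<lambda>\<gamma>. (onorm P)\<^sup>2 * (norm (f \<gamma>))\<^sup>2) summable_on UNIV"
      using f by (auto simp: H2_def intro: summable_on_cmult_right)
  qed (simp add: g_def Ple)
  have gsupp: "spec g \<subseteq> range \<alpha>" using supp by (auto simp: spec_def g_def P.zero)
  \<comment> \<open>The values \<open>x - P x\<close> lie in \<open>?Y\<close>, so the shifts of
    \<open>f\<close> and of \<open>g\<close> differ by an element of \<open>Ef f\<close>.\<close>
  have shifts: "bshift a g \<in> Ef f" for a
  proof -
    have "(\<lambda>\<gamma>. bshift a f \<gamma> - bshift a g \<gamma>) \<in> Ef f"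
      by (intro Ef_if_values_in_monomial_coeffs[OF f] H2_diff H2_bshift f g)
        (simp add: bshift_def g_def PY)
    from Ef_diff[OF f Ef_bshift[OF f] this, of a] show ?thesis by simp
  qed
  have summ: "summable (\<lambda>k. (norm (g (\<alpha> k)))\<^sup>2)"
  proof -
    have "(\<lambda>\<gamma>. (norm (g \<gamma>))\<^sup>2) summable_on range \<alpha>"
      using g unfolding H2_def by (auto intro: summable_on_subset_banach)
    then show ?thesis
      using summable_on_reindex[OF inj, of "\<lambda>\<gamma>. (norm (g \<gamma>))\<^sup>2"]
      by (auto simp: o_def intro: summable_on_imp_summable)
  qed
  have Yall: "?Y = UNIV"
  proof (rule ccontr)
    assume ne: "?Y \<noteq> UNIV"
    \<comment> \<open>Otherwise the coefficients from \<open>k\<close> on all lie in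
      \<open>?Y\<close>, and their dense span would make \<open>?Y\<close> everything.\<close>
    have inf: "\<exists>j\<ge>k. (norm (g (\<alpha> j)))\<^sup>2 \<noteq> 0" for k
    proof (rule ccontr)
      assume "\<not> ?thesis"
      then have "f (\<alpha> j) \<in> ?Y" if "j \<ge> k" for j
        using that PY[of "f (\<alpha> j)"] by (auto simp: g_def)
      then have "cspan {f (\<alpha> j) | j. j \<ge> k} \<subseteq> ?Y"
        unfolding cspan_def by (auto intro!: subspace_sum[OF sub] Yc)
      then have "closure (cspan {f (\<alpha> j) | j. j \<ge> k}) \<subseteq> ?Y"
        using cl by (rule closure_minimal)
      then show False using dense ne by auto
    qed
    define T where "T k = (\<Sum>j. (norm (g (\<alpha> j)))\<^sup>2) - (\<Sum>j<Suc k. (norm (g (\<alpha> j)))\<^sup>2)" for k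
    define w where "w k = (norm (g (\<alpha> k)))\<^sup>2 / T k" for k
    define v where "v k = (1 / norm (g (\<alpha> k))) *\<^sub>R g (\<alpha> k)" for k
    have Tpos: "0 < T k" for k
      unfolding T_def by (rule Abel_Dini_tail_divergence(1)[OF _ summ inf]) simp
    have "\<not> summable w"
      unfolding w_def[abs_def] T_def by (rule Abel_Dini_tail_divergence(2)[OF _ summ inf]) simp
    \<comment> \<open>The weight is 0 where \<open>g (\<alpha> k) = 0\<close>, so divergence
      persists on the indices where \<open>v k\<close> is a unit vector.\<close>
    moreover have "w summable_on {k. g (\<alpha> k) \<noteq> 0} \<longleftrightarrow> w summable_on UNIV"
      by (rule summable_on_cong_neutral) (auto simp: w_def)
    ultimately have div: "\<not> w summable_on {k. g (\<alpha> k) \<noteq> 0}"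
      using summable_on_imp_summable by blast
    let ?N = "{(1 / norm (P (f (\<alpha> k)))) *\<^sub>R P (f (\<alpha> k)) | k. P (f (\<alpha> k)) \<noteq> 0}"
    \<comment> \<open>The projection \<open>P\<close> depends on \<open>f\<close>, which is why
      compactness under every projection is assumed.\<close>
    have "compact (closure ?N)" using crc P unfolding completely_rel_compact_def by blast
    moreover have "v ` {k. g (\<alpha> k) \<noteq> 0} \<subseteq> closure ?N"
      by (rule order_trans[OF _ closure_subset]) (auto simp: v_def g_def)
    ultimately obtain u where u: "u \<in> closure ?N"
      and udiv: "\<And>e. e > 0 \<Longrightarrow> \<not> w summable_on {k\<in>{k. g (\<alpha> k) \<noteq> 0}. dist (v k) u < e}"
      using compact_imp_divergence_point[OF _ _ div] by blast
    \<comment> \<open>Both properties pass to limits of normalised projected coefficients; together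
      they exclude \<open>u\<close> from \<open>?Y\<close>, on which \<open>P\<close>
      vanishes.\<close>
    have "closed {x. norm x = 1 \<and> P x = x}"
      by (intro closed_Collect_conj closed_Collect_eq continuous_intros P.continuous_on)
    moreover have "?N \<subseteq> {x. norm x = 1 \<and> P x = x}" by (auto simp: P.scaleR PP)
    ultimately have "norm u = 1" "P u = u" using u closure_minimal by blast+
    moreover have "u \<in> ?Y"
      unfolding monomial_coeffs_def
    proof (intro CollectI allI)
      fix \<beta>
      show "monomial \<beta> u \<in> Ef f"
        using monomial_in_Ef_if_divergence_point[OF f g shifts inj gsupp overlap gaps summ,
            folded T_def, OF Tpos] udiv
        by (simp add: w_def[abs_def] v_def)
    qed
    ultimately show False using P0[of u] by simp
  qed
  then have "H2 \<subseteq> Ef f" using Ef_if_values_in_monomial_coeffs[OF f] by auto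
  then show ?thesis using Ef_subset_H2 by (auto simp: cyclic_def)
qed

theorem mainTheorem19:
  fixes f :: "('m::finite \<Rightarrow> nat) \<Rightarrow> 'a::complex_hilbert"
    and \<alpha> :: "nat \<Rightarrow> ('m \<Rightarrow> nat)"
  assumes sep: "separable_space TYPE('a)"
    and fH2: "f \<in> H2"
    and enum: "inj \<alpha>" "range \<alpha> = spec f"
    and C1: "\<exists>C::nat. \<forall>\<beta>::'m \<Rightarrow> int.
              finite {(a, a'). a \<in> spec f \<and> a' \<in> spec f \<and> a \<noteq> a' \<and>
                               (\<forall>j. int (a j) - int (a' j) = \<beta> j)}
            \<and> card {(a, a'). a \<in> spec f \<and> a' \<in> spec f \<and> a \<noteq> a' \<and>
                               (\<forall>j. int (a j) - int (a' j) = \<beta> j)} \<le> C"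
    and C2: "\<forall>j. filterlim (\<lambda>k. int (\<alpha> (Suc k) j) - int (\<alpha> k j)) at_top sequentially"
    and crc: "completely_rel_compact (\<lambda>k. f (\<alpha> k))"
  shows "cyclic f \<longleftrightarrow> (\<forall>k. closure (cspan {f (\<alpha> j) | j. j \<ge> k}) = UNIV)"
proof
  assume "cyclic f"
  then show "\<forall>k. closure (cspan {f (\<alpha> j) | j. j \<ge> k}) = UNIV"
    using cyclic_imp_tail_span_dense[OF fH2] enum by blast
next
  assume dense: "\<forall>k. closure (cspan {f (\<alpha> j) | j. j \<ge> k}) = UNIV"
  obtain C :: nat where C: "\<And>\<delta>::'m \<Rightarrow> int.
      finite {(a, a'). a \<in> spec f \<and> a' \<in> spec f \<and> a \<noteq> a' \<and> (\<forall>j. int (a j) - int (a' j) = \<delta> j)}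
      \<and> card {(a, a'). a \<in> spec f \<and> a' \<in> spec f \<and> a \<noteq> a' \<and> (\<forall>j. int (a j) - int (a' j) = \<delta> j)} \<le> C"
    using C1 by blast
  show "cyclic f"
  proof (rule tail_span_dense_imp_cyclic[OF fH2 enum(1) _ _ _ crc])
    show "finite {k. \<exists>j. j \<noteq> k \<and> (\<forall>i. int (\<alpha> j i) - int (\<alpha> k i) = \<delta> i)} \<and>
      card {k. \<exists>j. j \<noteq> k \<and> (\<forall>i. int (\<alpha> j i) - int (\<alpha> k i) = \<delta> i)} \<le> C" for \<delta>
      using overlap_of_difference_count[OF enum(1), of \<delta> C] C[of \<delta>] unfolding enum(2) by blast
  qed (use enum C2 dense in auto)
qed

end
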